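(* Let $D$ be a Lagrangian attaching disk of a Lagrangian surface $L$ in a symplectic 4-manifold, let $L'=\eta_D(L)$ be the result of the $la$-disk surgery, and let $D'=M(D)$ be the corresponding (dual) Lagrangian attaching disk of $L'$. Then $D$ and $D'$ have opposite relative polarities.
   Context: A Lagrangian attaching disk ($la$-disk) of $L$ is a closed embedded Lagrangian disk $D$ with $\partial D=D\cap L=:C$ and $T_CL\cap T_CD=TC$. Let $\mathcal G=\{g_\theta=\begin{pmatrix}\cos\theta&-\sin\theta\\ \sin\theta&\cos\theta\end{pmatrix}\mid\theta\in\mathbb R/2\pi\mathbb Z\}$ act on $\mathbb C^2\cong\mathbb R^4$ (coordinates $x_j+iy_j$, $\omega=\sum dx_j\wedge dy_j$). A neighborhood of $D$ can be symplectically identified with a domain in $\mathbb R^4$ containing a closed ball $B_r$ about $0$ so that $D=\{x_1^2+x_2^2\le(\sqrt2-1)^2r^2,\ y=0\}$ and $L\cap B_r=Q:=Orb_{\mathcal G}(\gamma)$, the $\mathcal G$-orbit of $\gamma(s)=(x_1=\sqrt2r+r\cos s,\ y_1=r\sin s)$, $s$ between $\frac{3\pi}{4}$ and $\frac{5\pi}{4}$. Let $M$ be the linear map exchanging $x_j$ and $y_j$, $Q'=M(Q)$, $\eta_D(L):=(L\setminus Q)\cup Q'$, $D'=M(D)$, $C'=M(C)=\partial D'$; $D'$ is a $la$-disk of $L'$. Relative polarity. Fix orientations of the annulus $Q$ and of the circle $C\subset Q$. Since $Q$ and $Q'$ are tangent along $\partial Q=\partial Q'$, $Q'$ inherits an orientation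 coinciding with that of $Q$ along the boundary, and $C'$ inherits a compatible orientation; explicitly, the orientations of $(Q',C')$ are transported from those of $(Q,C)$ by the isotopy $M_\theta\in SO(4)$, $\theta\in[0,\pi]$, $M_0=\mathrm{Id}$, $M_\pi=M$, where $M_\theta$ fixes $\mathrm{span}(\partial_{x_1}+\partial_{y_1},\partial_{x_2}+\partial_{y_2})$ pointwise and rotates the oriented plane $(-\partial_{x_1}+\partial_{y_1})\wedge(\partial_{x_2}-\partial_{y_2})$ by angle $\theta$. Let $\nu_C$ be a normal field to $C$ in $Q$ such that $(\nu_C,\dot C)$ is a positive basis of $T_CQ$, and $\nu_{C'}$ a normal field to $C'$ in $Q'$ such that $(\nu_{C'},\dot C')$ is a positive basis of $T_{C'}Q'$. Let $\nu,\nu'$ be the outward normals of $D$ along $C$ and of $D'$ along $C'$. $D$ and $D'$ have the same relative polarity if $\omega(\nu,\nu_C)$ and $\omega(\nu',\nu_{C'})$ have the same sign, and opposite relative polarities if they have different signs (independent of the choices of orientations). *)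

theory Defs
  imports "HOL-Analysis.Analysis"
begin

section \<open>Smooth 4-manifolds\<close>

text \<open>The model space is \<open>\<complex>\<^sup>2 = \<real>\<^sup>4\<close>; a point is \<open>(x\<^sub>1 + i y\<^sub>1, x\<^sub>2 + i y\<^sub>2)\<close>.\<close>

type_synonym c2 = "complex \<times> complex"

text \<open>A chart is a domain together with a map that is only relevant on that domain.\<close>

type_synonym 'a chart = "'a set \<times> ('a \<Rightarrow> c2)"

text \<open>For open \<open>S\<close>: all iterated directional derivatives exist (as Frechet derivatives) and
  are continuous.\<close>

primrec Ck_on :: "nat \<Rightarrow> 'v::real_normed_vector set \<Rightarrow> ('v \<Rightarrow> 'w::real_normed_vector) \<Rightarrow> bool" where
  "Ck_on 0 S f \<longleftrightarrow> continuous_on S f"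
| "Ck_on (Suc k) S f \<longleftrightarrow>
     (\<exists>f'. (\<forall>x\<in>S. (f has_derivative f' x) (at x)) \<and> (\<forall>v. Ck_on k S (\<lambda>x. f' x v)))"

definition smooth_on :: "'v::real_normed_vector set \<Rightarrow> ('v \<Rightarrow> 'w::real_normed_vector) \<Rightarrow> bool" where
  "smooth_on S f \<longleftrightarrow> (\<forall>k. Ck_on k S f)"

definition chart_inv :: "'a chart \<Rightarrow> c2 \<Rightarrow> 'a" where
  "chart_inv c = inv_into (fst c) (snd c)"

definition is_chart :: "'a::topological_space chart \<Rightarrow> bool" where
  "is_chart c \<longleftrightarrow> open (fst c) \<and> open (snd c ` fst c) \<and>
     homeomorphism (fst c) (snd c ` fst c) (snd c) (chart_inv c)"

definition transition :: "'a chart \<Rightarrow> 'a chart \<Rightarrow> c2 \<Rightarrow> c2" where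
  "transition c d = snd d \<circ> chart_inv c"

definition compatible :: "'a chart \<Rightarrow> 'a chart \<Rightarrow> bool" where
  "compatible c d \<longleftrightarrow>
     smooth_on (snd c ` (fst c \<inter> fst d)) (transition c d) \<and>
     smooth_on (snd d ` (fst c \<inter> fst d)) (transition d c)"

text \<open>A smooth structure is a maximal smooth atlas.\<close>

definition smooth_structure :: "'a::topological_space chart set \<Rightarrow> bool" where
  "smooth_structure A \<longleftrightarrow>
     (\<forall>c\<in>A. is_chart c) \<and> \<Union> (fst ` A) = UNIV \<and>
     (\<forall>c\<in>A. \<forall>d\<in>A. compatible c d) \<and>
     (\<forall>c. is_chart c \<and> (\<forall>d\<in>A. compatible c d) \<longrightarrow> c \<in> A)"

definition charts_at :: "'a chart set \<Rightarrow> 'a \<Rightarrow> 'a chart set" where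
  "charts_at A p = {c \<in> A. p \<in> fst c}"


section \<open>Tangent vectors\<close>

text \<open>A tangent vector at \<open>p\<close> is the family of its coordinate vectors in all charts around \<open>p\<close>,
  related by the derivatives of the transition maps; it is set to 0 at the other charts so that
  equality of tangent vectors is equality of functions.\<close>

type_synonym 'a tvec = "'a chart \<Rightarrow> c2"

definition tangent :: "'a chart set \<Rightarrow> 'a \<Rightarrow> 'a tvec set" where
  "tangent A p = {v.
     (\<forall>c\<in>charts_at A p. \<forall>d\<in>charts_at A p.
        v d = frechet_derivative (transition c d) (at (snd c p)) (v c)) \<and>
     (\<forall>c. c \<notin> charts_at A p \<longrightarrow> v c = 0)}"

definition of_coords :: "'a chart set \<Rightarrow> 'a chart \<Rightarrow> 'a \<Rightarrow> c2 \<Rightarrow> 'a tvec" where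
  "of_coords A c p u = (\<lambda>d. if d \<in> charts_at A p
     then frechet_derivative (transition c d) (at (snd c p)) u else 0)"

definition lincomb :: "real \<Rightarrow> 'a tvec \<Rightarrow> real \<Rightarrow> 'a tvec \<Rightarrow> 'a tvec" where
  "lincomb a u b v = (\<lambda>c. a *\<^sub>R u c + b *\<^sub>R v c)"

definition multiple :: "real \<Rightarrow> 'a tvec \<Rightarrow> 'a tvec" where
  "multiple a u = (\<lambda>c. a *\<^sub>R u c)"

text \<open>One-sided velocity at time 0. Continuity is required separately since a chart map says
  nothing about points outside its domain.\<close>

definition has_velocity :: "'a::topological_space chart set \<Rightarrow> (real \<Rightarrow> 'a) \<Rightarrow> 'a tvec \<Rightarrow> bool" where
  "has_velocity A \<gamma> v \<longleftrightarrow>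
     continuous (at 0 within {0..}) \<gamma> \<and> v \<in> tangent A (\<gamma> 0) \<and>
     (\<forall>c\<in>charts_at A (\<gamma> 0). ((snd c \<circ> \<gamma>) has_vector_derivative v c) (at 0 within {0..}))"

definition tangent_cone :: "'a::topological_space chart set \<Rightarrow> 'a set \<Rightarrow> 'a \<Rightarrow> 'a tvec set" where
  "tangent_cone A S p = {v. \<exists>\<gamma>. \<gamma> 0 = p \<and> (\<forall>t\<ge>0. \<gamma> t \<in> S) \<and> has_velocity A \<gamma> v}"

text \<open>The linear span of the tangent cone. For a submanifold with boundary this gives the full
  tangent space also at boundary points, where the tangent cone is only the closed half-space of
  inward vectors.\<close>

definition tangent_space :: "'a::topological_space chart set \<Rightarrow> 'a set \<Rightarrow> 'a \<Rightarrow> 'a tvec set" where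
  "tangent_space A S p = {v \<in> tangent A p.
     \<forall>c\<in>charts_at A p. v c \<in> span ((\<lambda>w. w c) ` tangent_cone A S p)}"

definition continuous_field ::
    "'a::topological_space chart set \<Rightarrow> 'a set \<Rightarrow> ('a \<Rightarrow> 'a tvec) \<Rightarrow> bool" where
  "continuous_field A S e \<longleftrightarrow>
     (\<forall>p\<in>S. e p \<in> tangent A p) \<and> (\<forall>c\<in>A. continuous_on (S \<inter> fst c) (\<lambda>p. e p c))"


section \<open>Symplectic forms, Lagrangian surfaces and attaching disks\<close>

definition form_in_chart ::
    "'a chart set \<Rightarrow> ('a \<Rightarrow> 'a tvec \<Rightarrow> 'a tvec \<Rightarrow> real) \<Rightarrow> 'a chart \<Rightarrow> c2 \<Rightarrow> c2 \<Rightarrow> c2 \<Rightarrow> real" where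
  "form_in_chart A \<omega> c x u v =
     (let p = chart_inv c x in \<omega> p (of_coords A c p u) (of_coords A c p v))"

text \<open>A smooth, closed, nondegenerate 2-form. The last conjunct is \<open>d\<omega> = 0\<close> evaluated on
  constant coordinate fields \<open>u, v, w\<close>.\<close>

definition symplectic_form ::
    "'a::topological_space chart set \<Rightarrow> ('a \<Rightarrow> 'a tvec \<Rightarrow> 'a tvec \<Rightarrow> real) \<Rightarrow> bool" where
  "symplectic_form A \<omega> \<longleftrightarrow> (\<forall>c\<in>A.
     (\<forall>x\<in>snd c ` fst c.
        bilinear (form_in_chart A \<omega> c x) \<and>
        (\<forall>u. form_in_chart A \<omega> c x u u = 0) \<and>
        (\<forall>u. (\<forall>v. form_in_chart A \<omega> c x u v = 0) \<longrightarrow> u = 0)) \<and>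
     (\<forall>u v. smooth_on (snd c ` fst c) (\<lambda>x. form_in_chart A \<omega> c x u v)) \<and>
     (\<forall>x\<in>snd c ` fst c. \<forall>u v w.
        frechet_derivative (\<lambda>y. form_in_chart A \<omega> c y v w) (at x) u +
        frechet_derivative (\<lambda>y. form_in_chart A \<omega> c y w u) (at x) v +
        frechet_derivative (\<lambda>y. form_in_chart A \<omega> c y u v) (at x) w = 0))"

definition symplectic_manifold ::
    "'a::{t2_space, second_countable_topology} chart set \<Rightarrow>
     ('a \<Rightarrow> 'a tvec \<Rightarrow> 'a tvec \<Rightarrow> real) \<Rightarrow> bool" where
  "symplectic_manifold A \<omega> \<longleftrightarrow> smooth_structure A \<and> symplectic_form A \<omega>"

definition smooth_immersion ::
    "'a::topological_space chart set \<Rightarrow> (real^2) set \<Rightarrow> (real^2 \<Rightarrow> 'a) \<Rightarrow> bool" where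
  "smooth_immersion A V f \<longleftrightarrow> open V \<and> continuous_on V f \<and>
     (\<forall>c\<in>A. smooth_on (V \<inter> f -` fst c) (snd c \<circ> f) \<and>
        (\<forall>x\<in>V \<inter> f -` fst c. inj (frechet_derivative (snd c \<circ> f) (at x))))"

definition embedded_surface :: "'a::topological_space chart set \<Rightarrow> 'a set \<Rightarrow> bool" where
  "embedded_surface A S \<longleftrightarrow> (\<forall>p\<in>S. \<exists>V W f g. smooth_immersion A V f \<and>
     open W \<and> p \<in> W \<and> homeomorphism V (S \<inter> W) f g)"

text \<open>\<open>f\<close> parametrizes the closed disk \<open>D\<close> and extends to an immersion of a neighbourhood of the
  closed unit disk; the boundary of \<open>D\<close> is then the image of the unit circle.\<close>

definition disk_embedding ::
    "'a::topological_space chart set \<Rightarrow> (real^2 \<Rightarrow> 'a) \<Rightarrow> 'a set \<Rightarrow> bool" where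
  "disk_embedding A f D \<longleftrightarrow> (\<exists>V. cball 0 1 \<subseteq> V \<and> smooth_immersion A V f) \<and>
     inj_on f (cball 0 1) \<and> D = f ` cball 0 1"

definition isotropic ::
    "'a::topological_space chart set \<Rightarrow> ('a \<Rightarrow> 'a tvec \<Rightarrow> 'a tvec \<Rightarrow> real) \<Rightarrow> 'a set \<Rightarrow> bool" where
  "isotropic A \<omega> S \<longleftrightarrow>
     (\<forall>p\<in>S. \<forall>u\<in>tangent_space A S p. \<forall>v\<in>tangent_space A S p. \<omega> p u v = 0)"

definition lagrangian_surface ::
    "'a::topological_space chart set \<Rightarrow> ('a \<Rightarrow> 'a tvec \<Rightarrow> 'a tvec \<Rightarrow> real) \<Rightarrow> 'a set \<Rightarrow> bool" where
  "lagrangian_surface A \<omega> L \<longleftrightarrow> embedded_surface A L \<and> isotropic A \<omega> L"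

definition la_disk ::
    "'a::topological_space chart set \<Rightarrow> ('a \<Rightarrow> 'a tvec \<Rightarrow> 'a tvec \<Rightarrow> real) \<Rightarrow>
     'a set \<Rightarrow> 'a set \<Rightarrow> bool" where
  "la_disk A \<omega> L D \<longleftrightarrow>
     (\<exists>f. disk_embedding A f D \<and> f ` sphere 0 1 = D \<inter> L) \<and>
     isotropic A \<omega> D \<and>
     (\<forall>p\<in>D \<inter> L. tangent_space A L p \<inter> tangent_space A D p = tangent_space A (D \<inter> L) p)"


section \<open>The local model and the surgery\<close>

definition omega0 :: "c2 \<Rightarrow> c2 \<Rightarrow> real" where
  "omega0 u v = (Re (fst u) * Im (fst v) - Im (fst u) * Re (fst v)) +
                (Re (snd u) * Im (snd v) - Im (snd u) * Re (snd v))"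

definition grot :: "real \<Rightarrow> c2 \<Rightarrow> c2" where
  "grot \<theta> z = (cos \<theta> *\<^sub>R fst z - sin \<theta> *\<^sub>R snd z, sin \<theta> *\<^sub>R fst z + cos \<theta> *\<^sub>R snd z)"

definition model_arc :: "real \<Rightarrow> real \<Rightarrow> c2" where
  "model_arc r s = (Complex (sqrt 2 * r + r * cos s) (r * sin s), 0)"

definition model_annulus :: "real \<Rightarrow> c2 set" where
  "model_annulus r = {grot \<theta> (model_arc r s) | \<theta> s. 3 * pi / 4 \<le> s \<and> s \<le> 5 * pi / 4}"

definition model_disk :: "real \<Rightarrow> c2 set" where
  "model_disk r = {z. Im (fst z) = 0 \<and> Im (snd z) = 0 \<and>
     (Re (fst z))\<^sup>2 + (Re (snd z))\<^sup>2 \<le> (sqrt 2 - 1)\<^sup>2 * r\<^sup>2}"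

definition swap_xy :: "c2 \<Rightarrow> c2" where
  "swap_xy z = (Complex (Im (fst z)) (Re (fst z)), Complex (Im (snd z)) (Re (snd z)))"

definition pull :: "'a chart \<Rightarrow> c2 set \<Rightarrow> 'a set" where
  "pull c S = {p \<in> fst c. snd c p \<in> S}"

text \<open>The symplectic identification of a neighbourhood of \<open>D\<close> with a domain of \<open>\<real>\<^sup>4\<close> is a chart
  \<open>c\<close> of the maximal atlas in which \<open>\<omega>\<close> is the standard form.\<close>

definition model_identification ::
    "'a::topological_space chart set \<Rightarrow> ('a \<Rightarrow> 'a tvec \<Rightarrow> 'a tvec \<Rightarrow> real) \<Rightarrow>
     'a set \<Rightarrow> 'a set \<Rightarrow> real \<Rightarrow> 'a chart \<Rightarrow> bool" where
  "model_identification A \<omega> L D r c \<longleftrightarrow>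
     c \<in> A \<and>
     (\<forall>p\<in>fst c. \<forall>u\<in>tangent A p. \<forall>v\<in>tangent A p. \<omega> p u v = omega0 (u c) (v c)) \<and>
     connected (snd c ` fst c) \<and>
     0 < r \<and> cball 0 r \<subseteq> snd c ` fst c \<and>
     D \<subseteq> fst c \<and> snd c ` D = model_disk r \<and>
     snd c ` (L \<inter> fst c) \<inter> cball 0 r = model_annulus r"

definition la_surgery :: "'a chart \<Rightarrow> real \<Rightarrow> 'a set \<Rightarrow> 'a set" where
  "la_surgery c r L = (L - pull c (model_annulus r)) \<union> pull c (swap_xy ` model_annulus r)"

definition dual_disk :: "'a chart \<Rightarrow> 'a set \<Rightarrow> 'a set" where
  "dual_disk c D = pull c (swap_xy ` snd c ` D)"

text \<open>\<open>M_isotopy \<theta>\<close> fixes the plane spanned by \<open>\<partial>\<^bsub>x1\<^esub> + \<partial>\<^bsub>y1\<^esub>\<close>, \<open>\<partial>\<^bsub>x2\<^esub> + \<partial>\<^bsub>y2\<^esub>\<close> and rotates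
  its orthogonal complement, oriented by the basis \<open>- \<partial>\<^bsub>x1\<^esub> + \<partial>\<^bsub>y1\<^esub>\<close>, \<open>\<partial>\<^bsub>x2\<^esub> - \<partial>\<^bsub>y2\<^esub>\<close>, by \<open>\<theta>\<close>;
  \<open>a\<close> and \<open>b\<close> are the coordinates in this basis, whose vectors have squared length 2.\<close>

definition anti1 :: c2 where "anti1 = (Complex (- 1) 1, 0)"

definition anti2 :: c2 where "anti2 = (0, Complex 1 (- 1))"

definition M_isotopy :: "real \<Rightarrow> c2 \<Rightarrow> c2" where
  "M_isotopy \<theta> z =
     (let a = (z \<bullet> anti1) / 2; b = (z \<bullet> anti2) / 2 in
      (z - a *\<^sub>R anti1 - b *\<^sub>R anti2) +
      a *\<^sub>R (cos \<theta> *\<^sub>R anti1 + sin \<theta> *\<^sub>R anti2) + b *\<^sub>R (- sin \<theta> *\<^sub>R anti1 + cos \<theta> *\<^sub>R anti2))"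

lemma M_isotopy_0: "M_isotopy 0 z = z"
  by (simp add: M_isotopy_def Let_def)

lemma M_isotopy_pi: "M_isotopy pi = swap_xy"
  by (auto simp: fun_eq_iff M_isotopy_def swap_xy_def Let_def anti1_def anti2_def
      inner_prod_def inner_complex_def prod_eq_iff complex_eq_iff field_simps)

lemma M_isotopy_diagonal:
  "M_isotopy \<theta> (Complex 1 1, 0) = (Complex 1 1, 0)" "M_isotopy \<theta> (0, Complex 1 1) = (0, Complex 1 1)"
  by (simp_all add: M_isotopy_def Let_def anti1_def anti2_def inner_prod_def inner_complex_def)

lemma M_isotopy_antidiagonal:
  "M_isotopy \<theta> anti1 = cos \<theta> *\<^sub>R anti1 + sin \<theta> *\<^sub>R anti2"
  "M_isotopy \<theta> anti2 = - sin \<theta> *\<^sub>R anti1 + cos \<theta> *\<^sub>R anti2"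
  by (auto simp: M_isotopy_def Let_def anti1_def anti2_def inner_prod_def inner_complex_def
      prod_eq_iff complex_eq_iff)

text \<open>The isotopy and its differential, read in the chart \<open>c\<close>.\<close>

definition flow :: "'a chart \<Rightarrow> real \<Rightarrow> 'a \<Rightarrow> 'a" where
  "flow c \<theta> p = chart_inv c (M_isotopy \<theta> (snd c p))"

definition flow_vec :: "'a chart set \<Rightarrow> 'a chart \<Rightarrow> real \<Rightarrow> 'a \<Rightarrow> 'a tvec \<Rightarrow> 'a tvec" where
  "flow_vec A c \<theta> p u = of_coords A c (flow c \<theta> p) (M_isotopy \<theta> (u c))"


section \<open>Orientations and relative polarity\<close>

text \<open>An orientation is the set of positive (ordered) bases at each point; it is locally
  represented by a continuous frame.\<close>

definition surface_orientation ::
    "'a::topological_space chart set \<Rightarrow> 'a set \<Rightarrow> ('a \<Rightarrow> ('a tvec \<times> 'a tvec) set) \<Rightarrow> bool" where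
  "surface_orientation A S ori \<longleftrightarrow> (\<forall>p\<in>S. \<exists>W e f. open W \<and> p \<in> W \<and>
     continuous_field A (S \<inter> W) e \<and> continuous_field A (S \<inter> W) f \<and>
     (\<forall>q\<in>S \<inter> W.
        bij_betw (\<lambda>(a, b). lincomb a (e q) b (f q)) UNIV (tangent_space A S q) \<and>
        ori q = {(lincomb a (e q) b (f q), lincomb a' (e q) b' (f q)) | a b a' b'.
                   a * b' - b * a' > 0}))"

definition curve_orientation ::
    "'a::topological_space chart set \<Rightarrow> 'a set \<Rightarrow> ('a \<Rightarrow> 'a tvec set) \<Rightarrow> bool" where
  "curve_orientation A C ori \<longleftrightarrow> (\<forall>p\<in>C. \<exists>W e. open W \<and> p \<in> W \<and>
     continuous_field A (C \<inter> W) e \<and>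
     (\<forall>q\<in>C \<inter> W.
        bij_betw (\<lambda>a. multiple a (e q)) UNIV (tangent_space A C q) \<and>
        ori q = {multiple a (e q) | a. a > 0}))"

text \<open>A continuous field along \<open>C\<close> that completes a positive tangent vector of \<open>C\<close> to a positive
  basis of the surface. No metric is fixed: "normal" means transverse.\<close>

definition positive_normal ::
    "'a::topological_space chart set \<Rightarrow> 'a set \<Rightarrow> ('a \<Rightarrow> ('a tvec \<times> 'a tvec) set) \<Rightarrow>
     ('a \<Rightarrow> 'a tvec set) \<Rightarrow> ('a \<Rightarrow> 'a tvec) \<Rightarrow> bool" where
  "positive_normal A C oriQ oriC n \<longleftrightarrow>
     continuous_field A C n \<and> (\<forall>p\<in>C. \<forall>t\<in>oriC p. (n p, t) \<in> oriQ p)"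

definition outward_normal ::
    "'a::topological_space chart set \<Rightarrow> 'a set \<Rightarrow> 'a set \<Rightarrow> ('a \<Rightarrow> 'a tvec) \<Rightarrow> bool" where
  "outward_normal A D C n \<longleftrightarrow> continuous_field A C n \<and>
     (\<forall>p\<in>C. multiple (- 1) (n p) \<in> tangent_cone A D p \<and> n p \<notin> tangent_space A C p)"

definition transported_orientations ::
    "'a chart set \<Rightarrow> 'a chart \<Rightarrow> 'a set \<Rightarrow> ('a \<Rightarrow> ('a tvec \<times> 'a tvec) set) \<Rightarrow>
     'a set \<Rightarrow> ('a \<Rightarrow> 'a tvec set) \<Rightarrow>
     ('a \<Rightarrow> ('a tvec \<times> 'a tvec) set) \<Rightarrow> ('a \<Rightarrow> 'a tvec set) \<Rightarrow> bool" where
  "transported_orientations A c Q oriQ C oriC oriQ' oriC' \<longleftrightarrow>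
     (\<forall>p\<in>Q. oriQ' (flow c pi p) = map_prod (flow_vec A c pi p) (flow_vec A c pi p) ` oriQ p) \<and>
     (\<forall>p\<in>C. oriC' (flow c pi p) = flow_vec A c pi p ` oriC p)"

text \<open>Here \<open>n, m\<close> are the fields \<open>\<nu>, \<nu>\<^sub>C\<close> for \<open>D\<close>, and \<open>n', m'\<close> those for \<open>D'\<close>.\<close>

definition polarity_fields ::
    "'a::topological_space chart set \<Rightarrow> 'a chart \<Rightarrow> real \<Rightarrow> 'a set \<Rightarrow> 'a set \<Rightarrow> 'a set \<Rightarrow> 'a set \<Rightarrow>
     ('a \<Rightarrow> 'a tvec) \<Rightarrow> ('a \<Rightarrow> 'a tvec) \<Rightarrow> ('a \<Rightarrow> 'a tvec) \<Rightarrow> ('a \<Rightarrow> 'a tvec) \<Rightarrow> bool" where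
  "polarity_fields A c r L D L' D' n m n' m' \<longleftrightarrow>
     (let Q = L \<inter> pull c (cball 0 r); Q' = L' \<inter> pull c (cball 0 r); C = D \<inter> L; C' = D' \<inter> L' in
      \<exists>oriQ oriC oriQ' oriC'.
        surface_orientation A Q oriQ \<and> curve_orientation A C oriC \<and>
        surface_orientation A Q' oriQ' \<and> curve_orientation A C' oriC' \<and>
        transported_orientations A c Q oriQ C oriC oriQ' oriC' \<and>
        outward_normal A D C n \<and> positive_normal A C oriQ oriC m \<and>
        outward_normal A D' C' n' \<and> positive_normal A C' oriQ' oriC' m')"

definition opposite_relative_polarity ::
    "'a::topological_space chart set \<Rightarrow> ('a \<Rightarrow> 'a tvec \<Rightarrow> 'a tvec \<Rightarrow> real) \<Rightarrow> 'a chart \<Rightarrow> real \<Rightarrow>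
     'a set \<Rightarrow> 'a set \<Rightarrow> 'a set \<Rightarrow> 'a set \<Rightarrow> bool" where
  "opposite_relative_polarity A \<omega> c r L D L' D' \<longleftrightarrow>
     (\<forall>n m n' m'. polarity_fields A c r L D L' D' n m n' m' \<longrightarrow>
        (\<forall>p\<in>D \<inter> L. \<forall>p'\<in>D' \<inter> L'. \<omega> p (n p) (m p) * \<omega> p' (n' p') (m' p') < 0))"

end

theory Submission
  imports Defs
begin

text \<open>In the model chart everything happens at a point \<open>x\<close> of the circle \<open>C\<close>, regarded as a real
  vector. The annulus \<open>Q\<close> is cut out by \<open>y\<^sub>1 x\<^sub>2 = x\<^sub>1 y\<^sub>2\<close> and \<open>(|z|\<^sup>2 + r\<^sup>2)\<^sup>2 = 8 r\<^sup>2 |Re z|\<^sup>2\<close>, so a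
  vector tangent to it has real part orthogonal to \<open>x\<close> and imaginary part parallel to \<open>x\<close>. Hence
  \<open>\<omega>(\<nu>, \<nu>\<^sub>C) |x|\<^sup>2 = (\<nu> \<bullet> x) \<omega>(x, \<nu>\<^sub>C)\<close>, whose sign is that of \<open>\<omega>(x, \<nu>\<^sub>C)\<close> and depends only on the
  orientations. The swap \<open>M\<close> carries outward normals to outward normals and positive bases to
  positive bases but satisfies \<open>M\<^sup>*\<omega> = -\<omega>\<close>, so the signs at \<open>q\<close> and \<open>M q\<close> are opposite; since \<open>C\<close> is
  connected, the sign does not depend on the point.\<close>

section \<open>Coordinates of tangent vectors\<close>

text \<open>The transition law recovers every component from the one in \<open>c\<close>, and the
  default 0 at all other charts leaves nothing free.\<close>

lemma tangent_eqI:
  assumes "u \<in> tangent A p" "v \<in> tangent A p" "c \<in> charts_at A p" "u c = v c"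
  shows "u = v"
proof
  fix d
  show "u d = v d"
  proof (cases "d \<in> charts_at A p")
    case True
    then have "u d = frechet_derivative (transition c d) (at (snd c p)) (u c)"
      and "v d = frechet_derivative (transition c d) (at (snd c p)) (v c)"
      using assms(1-3) unfolding tangent_def by blast+
    then show ?thesis using assms(4) by simp
  next
    case False
    then have "u d = 0" "v d = 0" using assms(1,2) unfolding tangent_def by blast+
    then show ?thesis by simp
  qed
qed

lemma chart_inv_left: "is_chart c \<Longrightarrow> p \<in> fst c \<Longrightarrow> chart_inv c (snd c p) = p"
  unfolding is_chart_def homeomorphism_def by blast

lemma chart_inv_right: "x \<in> snd c ` fst c \<Longrightarrow> snd c (chart_inv c x) = x"
  unfolding chart_inv_def by (rule f_inv_into_f)

lemma chart_inv_mem: "x \<in> snd c ` fst c \<Longrightarrow> chart_inv c x \<in> fst c"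
  unfolding chart_inv_def by (rule inv_into_into)

text \<open>\<open>transition c c\<close> is known to be the identity only on the image of the
  chart; that image is open, so this determines the derivative.\<close>

lemma of_coords_same_chart:
  assumes "is_chart c" "c \<in> charts_at A p"
  shows "of_coords A c p u c = u"
proof -
  have op: "open (snd c ` fst c)" using assms(1) unfolding is_chart_def by blast
  have p: "snd c p \<in> snd c ` fst c" using assms(2) unfolding charts_at_def by blast
  have "(transition c c has_derivative (\<lambda>h. h)) (at (snd c p))"
    by (rule has_derivative_transform_within_open[OF has_derivative_ident op p])
       (simp add: transition_def chart_inv_right)
  then have "frechet_derivative (transition c c) (at (snd c p)) = (\<lambda>h. h)"
    by (rule frechet_derivative_at[symmetric])
  then show ?thesis using assms(2) by (simp add: of_coords_def)
qed

text \<open>Along a curve in \<open>S\<close> issuing from \<open>p\<close>, \<open>\<phi>\<close>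
  never exceeds its initial value, so its one-sided derivative cannot be positive. All tangency
  conditions on \<open>D\<close>, \<open>C\<close> and \<open>Q\<close> are obtained this way by
  choosing \<open>\<phi>\<close>.\<close>

lemma tangent_cone_le:
  fixes \<phi> :: "c2 \<Rightarrow> real"
  assumes v: "v \<in> tangent_cone A S p" and c: "c \<in> charts_at A p"
    and \<phi>: "(\<phi> has_derivative \<phi>') (at (snd c p))"
    and le: "\<And>q. q \<in> S \<Longrightarrow> \<phi> (snd c q) \<le> \<phi> (snd c p)"
  shows "\<phi>' (v c) \<le> 0"
proof (rule ccontr)
  assume "\<not> \<phi>' (v c) \<le> 0"
  then have pos: "0 < \<phi>' (v c)" by simp
  obtain \<gamma> where \<gamma>: "\<gamma> 0 = p" "\<And>t. t \<ge> 0 \<Longrightarrow> \<gamma> t \<in> S" "has_velocity A \<gamma> v"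
    using v unfolding tangent_cone_def by blast
  have d: "((snd c \<circ> \<gamma>) has_derivative (\<lambda>h. h *\<^sub>R v c)) (at 0 within {0..})"
    using \<gamma> c unfolding has_velocity_def has_vector_derivative_def by blast
  have \<phi>0: "(\<phi> has_derivative \<phi>') (at ((snd c \<circ> \<gamma>) 0))" using \<phi> \<gamma>(1) by simp
  have "((\<lambda>t. \<phi> ((snd c \<circ> \<gamma>) t)) has_derivative (\<lambda>h. \<phi>' (h *\<^sub>R v c))) (at 0 within {0..})"
    using has_derivative_compose[OF d \<phi>0] .
  moreover have "(\<lambda>h. \<phi>' (h *\<^sub>R v c)) = (*) (\<phi>' (v c))"
    using linear_scale[OF has_derivative_linear[OF \<phi>]] by (auto simp: fun_eq_iff)
  ultimately have "((\<lambda>t. \<phi> ((snd c \<circ> \<gamma>) t)) has_real_derivative \<phi>' (v c)) (at 0 within {0..})"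
    unfolding has_field_derivative_def by simp
  \<comment> \<open>A positive right derivative forces strict growth just after time 0; time
    \<open>\<delta> / 2\<close> then contradicts maximality at \<open>p\<close>.\<close>
  from has_real_derivative_pos_inc_right[OF this pos] obtain \<delta> where \<delta>: "\<delta> > 0"
    "\<And>h. h > 0 \<Longrightarrow> 0 + h \<in> {0..} \<Longrightarrow> h < \<delta> \<Longrightarrow> \<phi> ((snd c \<circ> \<gamma>) 0) < \<phi> ((snd c \<circ> \<gamma>) (0 + h))"
    by blast
  have "\<phi> (snd c p) < \<phi> (snd c (\<gamma> (\<delta> / 2)))" using \<delta>(2)[of "\<delta> / 2"] \<delta>(1) \<gamma>(1) by simp
  then show False using le[OF \<gamma>(2)[of "\<delta> / 2"]] \<delta>(1) by simp
qed

lemma tangent_cone_eq: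
  fixes \<phi> :: "c2 \<Rightarrow> real"
  assumes v: "v \<in> tangent_cone A S p" and c: "c \<in> charts_at A p"
    and \<phi>: "(\<phi> has_derivative \<phi>') (at (snd c p))"
    and eq: "\<And>q. q \<in> S \<Longrightarrow> \<phi> (snd c q) = \<phi> (snd c p)"
  shows "\<phi>' (v c) = 0"
proof -
  have "\<phi>' (v c) \<le> 0" using tangent_cone_le[OF v c \<phi>] eq by simp
  moreover have "- \<phi>' (v c) \<le> 0"
    using tangent_cone_le[OF v c has_derivative_minus[OF \<phi>]] eq by simp
  ultimately show ?thesis by simp
qed

text \<open>The kernel of \<open>\<phi>'\<close> is a subspace containing the cone, hence also its
  span.\<close>

lemma tangent_space_eq:
  fixes \<phi> :: "c2 \<Rightarrow> real"
  assumes v: "v \<in> tangent_space A S p" and c: "c \<in> charts_at A p"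
    and \<phi>: "(\<phi> has_derivative \<phi>') (at (snd c p))"
    and eq: "\<And>q. q \<in> S \<Longrightarrow> \<phi> (snd c q) = \<phi> (snd c p)"
  shows "\<phi>' (v c) = 0"
proof -
  have "v c \<in> span ((\<lambda>w. w c) ` tangent_cone A S p)"
    using v c unfolding tangent_space_def by blast
  moreover have "subspace {w. \<phi>' w = 0}"
    by (rule linear_subspace_kernel[OF has_derivative_linear[OF \<phi>]])
  moreover have "(\<lambda>w. w c) ` tangent_cone A S p \<subseteq> {w. \<phi>' w = 0}"
    using tangent_cone_eq[OF _ c \<phi> eq] by blast
  ultimately show ?thesis using span_minimal by blast
qed

lemma tangent_space_tangent: "tangent_space A S p \<subseteq> tangent A p"
  unfolding tangent_space_def by blast

section \<open>The local model\<close>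

text \<open>The model of \<open>C\<close>. The radius is fixed through an inner product, which is
  easy to differentiate and invariant under the swap.\<close>

definition model_circle :: "real \<Rightarrow> c2 set" where
  "model_circle r = {z. Im (fst z) = 0 \<and> Im (snd z) = 0 \<and> z \<bullet> z = ((sqrt 2 - 1) * r)\<^sup>2}"

lemma inner_c2:
  "(z::c2) \<bullet> w = Re (fst z) * Re (fst w) + Im (fst z) * Im (fst w)
     + (Re (snd z) * Re (snd w) + Im (snd z) * Im (snd w))"
  by (simp add: inner_prod_def inner_complex_def)

lemma model_disk_iff:
  "z \<in> model_disk r \<longleftrightarrow> Im (fst z) = 0 \<and> Im (snd z) = 0 \<and> z \<bullet> z \<le> ((sqrt 2 - 1) * r)\<^sup>2"
  by (auto simp: model_disk_def inner_c2 power2_eq_square mult_ac)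

lemma model_circle_subset_disk: "model_circle r \<subseteq> model_disk r"
  by (auto simp: model_circle_def model_disk_iff)

text \<open>At \<open>s = pi\<close> the arc crosses the real plane at first coordinate
  \<open>(sqrt 2 - 1) * r\<close>, so the circle is a single rotation orbit. Its inclusion in the
  annulus and its connectedness follow from this.\<close>

lemma model_circle_parametrized:
  "model_circle r = range (\<lambda>\<theta>. grot \<theta> (model_arc r pi))"
proof (intro equalityI subsetI)
  fix z assume "z \<in> model_circle r"
  then have im: "Im (fst z) = 0" "Im (snd z) = 0"
    and sq: "(Re (fst z))\<^sup>2 + (Re (snd z))\<^sup>2 = ((sqrt 2 - 1) * r)\<^sup>2"
    by (auto simp: model_circle_def inner_c2 power2_eq_square)
  have "\<exists>\<theta>. Re (fst z) = (sqrt 2 - 1) * r * cos \<theta> \<and> Re (snd z) = (sqrt 2 - 1) * r * sin \<theta>"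
  proof (cases "r = 0")
    case True
    then show ?thesis using sq by (simp add: sum_power2_eq_zero_iff)
  next
    case False
    then have nz: "((sqrt 2 - 1) * r) \<noteq> 0" by simp
    have "(Re (fst z) / ((sqrt 2 - 1) * r))\<^sup>2 + (Re (snd z) / ((sqrt 2 - 1) * r))\<^sup>2 = 1"
      using sq nz by (simp add: power_divide flip: add_divide_distrib)
    then obtain \<theta> where "Re (fst z) / ((sqrt 2 - 1) * r) = cos \<theta>"
      "Re (snd z) / ((sqrt 2 - 1) * r) = sin \<theta>"
      by (meson sincos_total_2pi)
    then show ?thesis using nz by (intro exI[of _ \<theta>]) (simp add: field_simps)
  qed
  then obtain \<theta> where "Re (fst z) = (sqrt 2 - 1) * r * cos \<theta>" "Re (snd z) = (sqrt 2 - 1) * r * sin \<theta>"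
    by blast
  then have "z = grot \<theta> (model_arc r pi)" using im
    by (simp add: grot_def model_arc_def prod_eq_iff complex_eq_iff algebra_simps)
  then show "z \<in> range (\<lambda>\<theta>. grot \<theta> (model_arc r pi))" by blast
next
  fix z assume "z \<in> range (\<lambda>\<theta>. grot \<theta> (model_arc r pi))"
  then obtain \<theta> where z: "z = grot \<theta> (model_arc r pi)" by blast
  have "(cos \<theta> * ((sqrt 2 - 1) * r))\<^sup>2 + (sin \<theta> * ((sqrt 2 - 1) * r))\<^sup>2
      = ((cos \<theta>)\<^sup>2 + (sin \<theta>)\<^sup>2) * ((sqrt 2 - 1) * r)\<^sup>2"
    by (simp only: power_mult_distrib distrib_right)
  then show "z \<in> model_circle r" unfolding z
    by (simp add: model_circle_def grot_def model_arc_def inner_c2 power2_eq_square algebra_simps)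
qed

lemma model_circle_subset_annulus: "model_circle r \<subseteq> model_annulus r"
  unfolding model_circle_parametrized model_annulus_def by fastforce

lemma connected_model_circle: "connected (model_circle r)"
  unfolding model_circle_parametrized grot_def
  by (intro connected_continuous_image connected_UNIV continuous_intros)

lemma model_annulus_cases:
  assumes "z \<in> model_annulus r"
  obtains \<theta> s where "3 * pi / 4 \<le> s" "s \<le> 5 * pi / 4"
    "Re (fst z) = cos \<theta> * (r * (sqrt 2 + cos s))" "Im (fst z) = cos \<theta> * (r * sin s)"
    "Re (snd z) = sin \<theta> * (r * (sqrt 2 + cos s))" "Im (snd z) = sin \<theta> * (r * sin s)"
proof -
  obtain \<theta> s where "z = grot \<theta> (model_arc r s)" "3 * pi / 4 \<le> s" "s \<le> 5 * pi / 4"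
    using assms unfolding model_annulus_def by blast
  then show thesis by (intro that[of s \<theta>]) (simp_all add: grot_def model_arc_def algebra_simps)
qed

text \<open>The vectors Re z and Im z are both multiples of (cos \<theta>, sin \<theta>), so their
  determinant vanishes. With \<rho> and \<eta> the two multipliers, the profile circle centred at
  \<open>sqrt 2 * r\<close> reads \<rho>^2 + \<eta>^2 + r^2 = 2 sqrt 2 r \<rho>; squaring makes it
  polynomial in the coordinates.\<close>

lemma model_annulus_equations:
  assumes "z \<in> model_annulus r"
  shows "Im (fst z) * Re (snd z) - Re (fst z) * Im (snd z) = 0"
    and "(z \<bullet> z + r\<^sup>2)\<^sup>2 - 8 * r\<^sup>2 * ((Re (fst z))\<^sup>2 + (Re (snd z))\<^sup>2) = 0"
proof -
  obtain \<theta> s where z: "Re (fst z) = cos \<theta> * (r * (sqrt 2 + cos s))" "Im (fst z) = cos \<theta> * (r * sin s)"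
    "Re (snd z) = sin \<theta> * (r * (sqrt 2 + cos s))" "Im (snd z) = sin \<theta> * (r * sin s)"
    using model_annulus_cases[OF assms] by metis
  show "Im (fst z) * Re (snd z) - Re (fst z) * Im (snd z) = 0"
    unfolding z by (simp add: algebra_simps)
  have re: "(Re (fst z))\<^sup>2 + (Re (snd z))\<^sup>2 = (r * (sqrt 2 + cos s))\<^sup>2"
    unfolding z power_mult_distrib[of "cos \<theta>"] power_mult_distrib[of "sin \<theta>"]
    by (simp add: flip: distrib_right)
  have im: "(Im (fst z))\<^sup>2 + (Im (snd z))\<^sup>2 = (r * sin s)\<^sup>2"
    unfolding z power_mult_distrib[of "cos \<theta>"] power_mult_distrib[of "sin \<theta>"]
    by (simp add: flip: distrib_right)
  have "z \<bullet> z = (r * (sqrt 2 + cos s))\<^sup>2 + (r * sin s)\<^sup>2"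
    using re im by (simp add: inner_c2 power2_eq_square)
  also have "\<dots> = r\<^sup>2 * ((sqrt 2 + cos s)\<^sup>2 + (sin s)\<^sup>2)"
    unfolding power_mult_distrib by (rule distrib_left[symmetric])
  also have "(sqrt 2 + cos s)\<^sup>2 + (sin s)\<^sup>2 = 2 + 2 * sqrt 2 * cos s + ((cos s)\<^sup>2 + (sin s)\<^sup>2)"
    by (simp add: power2_sum del: sin_cos_squared_add2)
  finally have "z \<bullet> z + r\<^sup>2 = r\<^sup>2 * (2 * sqrt 2) * (sqrt 2 + cos s)"
    by (simp add: algebra_simps)
  then have "(z \<bullet> z + r\<^sup>2)\<^sup>2 = 8 * r\<^sup>2 * (r * (sqrt 2 + cos s))\<^sup>2"
    by (simp add: power_mult_distrib)
  then show "(z \<bullet> z + r\<^sup>2)\<^sup>2 - 8 * r\<^sup>2 * ((Re (fst z))\<^sup>2 + (Re (snd z))\<^sup>2) = 0"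
    unfolding re by simp
qed

text \<open>A real point of the annulus has sin s = 0, because cos \<theta> and sin \<theta> do not
  vanish together; in the given range of \<open>s\<close> only the core circle remains.\<close>

lemma model_disk_Int_annulus:
  assumes "0 < r"
  shows "model_disk r \<inter> model_annulus r = model_circle r"
proof (intro equalityI subsetI)
  fix z assume "z \<in> model_disk r \<inter> model_annulus r"
  then have zd: "z \<in> model_disk r" and za: "z \<in> model_annulus r" by auto
  obtain \<theta> s where s: "3 * pi / 4 \<le> s" "s \<le> 5 * pi / 4"
    and z: "Re (fst z) = cos \<theta> * (r * (sqrt 2 + cos s))" "Im (fst z) = cos \<theta> * (r * sin s)"
    "Re (snd z) = sin \<theta> * (r * (sqrt 2 + cos s))" "Im (snd z) = sin \<theta> * (r * sin s)"
    using model_annulus_cases[OF za] by metis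
  have "cos \<theta> * sin s = 0" "sin \<theta> * sin s = 0"
    using z zd assms unfolding model_disk_iff by auto
  moreover have "cos \<theta> \<noteq> 0 \<or> sin \<theta> \<noteq> 0" using sin_cos_squared_add[of \<theta>] by (metis zero_neq_one power_zero_numeral add_0)
  ultimately have sin0: "sin s = 0" by auto
  \<comment> \<open>The shift moves \<open>s\<close> into the open interval from -pi to pi, where 0
    is the only zero of sin.\<close>
  have "sin (s - pi) = 0" using sin0 by (simp add: sin_diff)
  moreover have "- pi < s - pi" "s - pi < pi" using s pi_gt_zero by linarith+
  ultimately have "s - pi = 0" by (rule sin_eq_0_pi[rotated 2])
  then have "cos s = -1" by simp
  then have "z = grot \<theta> (model_arc r pi)"
    using z sin0 by (simp add: grot_def model_arc_def prod_eq_iff complex_eq_iff algebra_simps)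
  then show "z \<in> model_circle r" unfolding model_circle_parametrized by blast
qed (use model_circle_subset_disk model_circle_subset_annulus in blast)

section \<open>The swap as an anti-symplectic linear isometry\<close>

lemma bounded_linear_swap_xy: "bounded_linear swap_xy"
  unfolding linear_conv_bounded_linear[symmetric]
  by (rule linearI) (simp_all add: swap_xy_def prod_eq_iff complex_eq_iff)

lemma swap_xy_swap_xy [simp]: "swap_xy (swap_xy z) = z"
  by (simp add: swap_xy_def prod_eq_iff complex_eq_iff)

lemma mem_swap_xy_image: "z \<in> swap_xy ` S \<longleftrightarrow> swap_xy z \<in> S"
  by (metis imageE imageI swap_xy_swap_xy)

lemma inner_swap_xy [simp]: "swap_xy z \<bullet> swap_xy w = z \<bullet> w"
  by (simp add: inner_c2 swap_xy_def)

lemma omega0_swap_xy: "omega0 (swap_xy u) (swap_xy v) = - omega0 u v"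
  by (simp add: omega0_def swap_xy_def)

lemma mem_cball_c2: "0 < r \<Longrightarrow> z \<in> cball (0::c2) r \<longleftrightarrow> z \<bullet> z \<le> r\<^sup>2"
  by (simp add: dot_square_norm power2_le_iff_abs_le)

lemma model_disk_subset_cball:
  assumes "0 < r"
  shows "model_disk r \<subseteq> cball 0 r"
proof
  fix z assume "z \<in> model_disk r"
  then have "z \<bullet> z \<le> ((sqrt 2 - 1) * r)\<^sup>2" unfolding model_disk_iff by blast
  also have "\<dots> \<le> r\<^sup>2"
    by (rule power_mono)
       (use assms sqrt2_less_2 in \<open>auto intro!: mult_left_le_one_le\<close>)
  finally show "z \<in> cball 0 r" using mem_cball_c2[OF assms] by blast
qed

section \<open>Tangent and normal vectors of the model\<close>

text \<open>In the real plane the vectors orthogonal to the nonzero \<open>x\<close> form a line,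
  which \<open>u\<close> spans.\<close>

lemma planar_collinear:
  assumes "Im (fst x) = 0" "Im (snd x) = 0" "Im (fst u) = 0" "Im (snd u) = 0"
    "Im (fst v) = 0" "Im (snd v) = 0" and x: "x \<noteq> (0::c2)" and u: "u \<noteq> 0"
    and xu: "x \<bullet> u = 0" and xv: "x \<bullet> v = 0"
  shows "\<exists>k. v = k *\<^sub>R u"
proof -
  define a b where "a = Re (fst x)" and "b = Re (snd x)"
  define u1 u2 v1 v2 where "u1 = Re (fst u)" and "u2 = Re (snd u)"
    and "v1 = Re (fst v)" and "v2 = Re (snd v)"
  have ab: "a * u1 + b * u2 = 0" "a * v1 + b * v2 = 0"
    using xu xv assms(1-6) by (simp_all add: inner_c2 a_def b_def u1_def u2_def v1_def v2_def)
  have "a \<noteq> 0 \<or> b \<noteq> 0"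
    using x assms(1,2) by (auto simp: a_def b_def prod_eq_iff complex_eq_iff)
  \<comment> \<open>Both coordinates of \<open>x\<close> annihilate the determinant of
    \<open>u\<close> and \<open>v\<close>, and one of them is nonzero.\<close>
  moreover have "a * (u1 * v2 - u2 * v1) = 0" "b * (u1 * v2 - u2 * v1) = 0" using ab by algebra+
  ultimately have det: "u1 * v2 = u2 * v1" by auto
  have "u1 \<noteq> 0 \<or> u2 \<noteq> 0"
    using u assms(3,4) by (auto simp: u1_def u2_def prod_eq_iff complex_eq_iff)
  then have "\<exists>k. v1 = k * u1 \<and> v2 = k * u2"
  proof
    assume "u1 \<noteq> 0"
    then show ?thesis using det by (intro exI[of _ "v1 / u1"]) (simp add: field_simps)
  next
    assume "u2 \<noteq> 0"
    then show ?thesis using det by (intro exI[of _ "v2 / u2"]) (simp add: field_simps)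
  qed
  then show ?thesis
    using assms(3-6) by (auto simp: u1_def u2_def v1_def v2_def prod_eq_iff complex_eq_iff)
qed

text \<open>The map \<open>J\<close> below is the identity for \<open>D\<close> and the swap for \<open>D'\<close>.\<close>

lemma disk_functionals_derivative:
  assumes "bounded_linear (J :: c2 \<Rightarrow> c2)"
  shows "((\<lambda>z. Im (fst (J z))) has_derivative (\<lambda>h. Im (fst (J h)))) (at z)"
    and "((\<lambda>z. Im (snd (J z))) has_derivative (\<lambda>h. Im (snd (J h)))) (at z)"
    and "((\<lambda>z. J z \<bullet> J z) has_derivative (\<lambda>h. 2 * (J z \<bullet> J h))) (at z)"
proof -
  have J: "(J has_derivative J) (at z)"
    using assms by (rule bounded_linear_imp_has_derivative)
  show "((\<lambda>z. Im (fst (J z))) has_derivative (\<lambda>h. Im (fst (J h)))) (at z)"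
    by (intro has_derivative_Im has_derivative_fst J)
  show "((\<lambda>z. Im (snd (J z))) has_derivative (\<lambda>h. Im (snd (J h)))) (at z)"
    by (intro has_derivative_Im has_derivative_snd J)
  show "((\<lambda>z. J z \<bullet> J z) has_derivative (\<lambda>h. 2 * (J z \<bullet> J h))) (at z)"
    by (rule has_derivative_eq_rhs[OF has_derivative_inner[OF J J]])
       (simp add: fun_eq_iff inner_commute)
qed

text \<open>The imaginary parts are constant on the disk, while the squared norm is maximal at its
  boundary: this gives two equalities and one inequality.\<close>

lemma disk_tangent_cone:
  assumes J: "bounded_linear J" and c: "c \<in> charts_at A p"
    and D: "\<And>q. q \<in> D \<Longrightarrow> J (snd c q) \<in> model_disk r"
    and p: "J (snd c p) \<in> model_circle r"
    and v: "v \<in> tangent_cone A D p"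
  shows "Im (fst (J (v c))) = 0" "Im (snd (J (v c))) = 0" "J (snd c p) \<bullet> J (v c) \<le> 0"
proof -
  note \<phi> = disk_functionals_derivative[OF J, of "snd c p"]
  show "Im (fst (J (v c))) = 0"
    using tangent_cone_eq[OF v c \<phi>(1)] D p unfolding model_disk_iff model_circle_def by simp
  show "Im (snd (J (v c))) = 0"
    using tangent_cone_eq[OF v c \<phi>(2)] D p unfolding model_disk_iff model_circle_def by simp
  show "J (snd c p) \<bullet> J (v c) \<le> 0"
    using tangent_cone_le[OF v c \<phi>(3)] D p unfolding model_disk_iff model_circle_def by simp
qed

lemma circle_tangent_space:
  assumes J: "bounded_linear J" and c: "c \<in> charts_at A p"
    and C: "\<And>q. q \<in> C \<Longrightarrow> J (snd c q) \<in> model_circle r"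
    and p: "p \<in> C"
    and v: "v \<in> tangent_space A C p"
  shows "Im (fst (J (v c))) = 0" "Im (snd (J (v c))) = 0" "J (snd c p) \<bullet> J (v c) = 0"
proof -
  note \<phi> = disk_functionals_derivative[OF J, of "snd c p"]
  show "Im (fst (J (v c))) = 0"
    using tangent_space_eq[OF v c \<phi>(1)] C C[OF p] unfolding model_circle_def by simp
  show "Im (snd (J (v c))) = 0"
    using tangent_space_eq[OF v c \<phi>(2)] C C[OF p] unfolding model_circle_def by simp
  show "J (snd c p) \<bullet> J (v c) = 0"
    using tangent_space_eq[OF v c \<phi>(3)] C C[OF p] unfolding model_circle_def by simp
qed

text \<open>The cone condition on the inward vector only yields a weak inequality. Equality would
  put the normal on the tangent line of \<open>C\<close>, which transversality excludes.\<close>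

lemma outward_normal_coords:
  assumes J: "bounded_linear J" "inj J" and c: "c \<in> charts_at A p" and r: "0 < r"
    and D: "\<And>q. q \<in> D \<Longrightarrow> J (snd c q) \<in> model_disk r"
    and C: "\<And>q. q \<in> C \<Longrightarrow> J (snd c q) \<in> model_circle r"
    and p: "p \<in> C"
    and ori: "curve_orientation A C oriC"
    and n: "outward_normal A D C n"
  shows "Im (fst (J (n p c))) = 0" "Im (snd (J (n p c))) = 0" "0 < J (snd c p) \<bullet> J (n p c)"
proof -
  interpret J: bounded_linear J by fact
  let ?x = "J (snd c p)"
  have cone: "multiple (- 1) (n p) \<in> tangent_cone A D p" and notin: "n p \<notin> tangent_space A C p"
    and nt: "n p \<in> tangent A p"
    using n p unfolding outward_normal_def continuous_field_def by blast+
  note nD = disk_tangent_cone[OF J(1) c D C[OF p] cone]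
  show im: "Im (fst (J (n p c))) = 0" "Im (snd (J (n p c))) = 0"
    using nD by (simp_all add: multiple_def linear_neg[OF J.linear])
  have ge: "0 \<le> ?x \<bullet> J (n p c)" using nD by (simp add: multiple_def linear_neg[OF J.linear])
  have "?x \<bullet> J (n p c) \<noteq> 0"
  proof
    assume xn: "?x \<bullet> J (n p c) = 0"
    \<comment> \<open>The orientation supplies the fact that the tangent space of \<open>C\<close>
      is a line, with generator \<open>e p\<close>.\<close>
    obtain e where e: "bij_betw (\<lambda>a. multiple a (e p)) UNIV (tangent_space A C p)"
      using ori p unfolding curve_orientation_def by blast
    have mem: "multiple a (e p) \<in> tangent_space A C p" for a
      using e unfolding bij_betw_def by blast
    have e1: "multiple 1 (e p) = e p" by (simp add: multiple_def)
    note eC = circle_tangent_space[OF J(1) c C p mem[of 1, unfolded e1]]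
    have "J (e p c) \<noteq> 0"
    proof
      assume "J (e p c) = 0"
      then have "e p c = 0" using J(2) linear_0[OF J.linear] by (metis injD)
      \<comment> \<open>A generator with zero coordinates would make the multiples 0 and 1 coincide,
        against bijectivity.\<close>
      then have "multiple 0 (e p) = multiple 1 (e p)"
        using tangent_eqI[OF _ _ c] mem tangent_space_tangent[of A C p]
        by (metis (no_types, lifting) multiple_def scaleR_zero_right subsetD)
      then show False using e unfolding bij_betw_def inj_def by (metis zero_neq_one)
    qed
    moreover have "?x \<noteq> 0" "Im (fst ?x) = 0" "Im (snd ?x) = 0"
      using C[OF p] r unfolding model_circle_def by auto
    ultimately obtain k where "J (n p c) = k *\<^sub>R J (e p c)"
      using planar_collinear eC im xn by meson
    then have "J (n p c) = J (multiple k (e p) c)" by (simp add: multiple_def linear_scale[OF J.linear])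
    then have "n p c = multiple k (e p) c" using J(2) by (rule injD[rotated])
    then have "n p = multiple k (e p)"
      using tangent_eqI[OF nt _ c] mem tangent_space_tangent[of A C p] by blast
    then show False using mem notin by simp
  qed
  then show "0 < ?x \<bullet> J (n p c)" using ge by simp
qed

text \<open>Differentiating the two annulus equations at a real point: the second makes the real
  part of \<open>v c\<close> orthogonal to \<open>x\<close>, the first makes its imaginary part
  parallel to \<open>x\<close>.\<close>

lemma annulus_tangent_space:
  assumes c: "c \<in> charts_at A p" and r: "0 < r"
    and Q: "\<And>q. q \<in> Q \<Longrightarrow> snd c q \<in> model_annulus r"
    and p: "p \<in> Q" "snd c p \<in> model_circle r"
    and v: "v \<in> tangent_space A Q p"
  defines "x \<equiv> snd c p"
  shows "Re (fst x) * Re (fst (v c)) + Re (snd x) * Re (snd (v c)) = 0"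
    and "Im (fst (v c)) * Re (snd x) = Im (snd (v c)) * Re (fst x)"
proof -
  have im: "Im (fst x) = 0" "Im (snd x) = 0" and xx: "x \<bullet> x = ((sqrt 2 - 1) * r)\<^sup>2"
    using p(2) unfolding x_def model_circle_def by auto
  let ?\<phi> = "\<lambda>z. Im (fst z) * Re (snd z) - Re (fst z) * Im (snd z)"
  have "(?\<phi> has_derivative (\<lambda>h. Im (fst h) * Re (snd x) - Re (fst x) * Im (snd h))) (at (snd c p))"
    unfolding x_def[symmetric]
    by (rule derivative_eq_intros refl)+ (simp add: fun_eq_iff im algebra_simps)
  from tangent_space_eq[OF v c this]
  show "Im (fst (v c)) * Re (snd x) = Im (snd (v c)) * Re (fst x)"
    using model_annulus_equations(1)[OF Q] p(1) by simp
  let ?\<psi> = "\<lambda>z::c2. (z \<bullet> z + r\<^sup>2)\<^sup>2 - 8 * r\<^sup>2 * ((Re (fst z))\<^sup>2 + (Re (snd z))\<^sup>2)"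
  let ?d = "\<lambda>h. Re (fst x) * Re (fst h) + Re (snd x) * Re (snd h)"
  have "(?\<psi> has_derivative (\<lambda>h. (4 * (x \<bullet> x + r\<^sup>2) - 16 * r\<^sup>2) * ?d h)) (at (snd c p))"
    unfolding x_def[symmetric]
    by (rule derivative_eq_intros refl)+ (simp add: fun_eq_iff inner_c2 im algebra_simps)
  from tangent_space_eq[OF v c this]
  have "(4 * (x \<bullet> x + r\<^sup>2) - 16 * r\<^sup>2) * ?d (v c) = 0"
    using model_annulus_equations(2)[OF Q] p(1) by simp
  \<comment> \<open>On the circle the squared norm is (3 - 2 sqrt 2) r^2, so the factor is nonzero
    and can be cancelled.\<close>
  moreover have "4 * (x \<bullet> x + r\<^sup>2) - 16 * r\<^sup>2 = - 8 * sqrt 2 * r\<^sup>2"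
    unfolding xx by (simp add: power2_eq_square algebra_simps)
  ultimately have "sqrt 2 * r\<^sup>2 * ?d (v c) = 0" by algebra
  then show "?d (v c) = 0" using r by simp
qed

text \<open>For real \<open>n\<close>, \<open>omega0 n v\<close> pairs \<open>n\<close> with the
  imaginary part of \<open>v\<close>. As that part is parallel to \<open>x\<close>, only the
  component of \<open>n\<close> along \<open>x\<close> counts; the factor
  \<open>x \<bullet> x\<close> avoids a division.\<close>

lemma omega0_outward:
  assumes "Im (fst n) = 0" "Im (snd n) = 0" "Im (fst x) = 0" "Im (snd x) = 0"
    and "Im (fst v) * Re (snd x) = Im (snd v) * Re (fst x)"
  shows "omega0 n v * (x \<bullet> x) = (x \<bullet> n) * omega0 x v"
proof -
  have "(n1 * v1 + n2 * v2) * (x1 * x1 + x2 * x2) = (x1 * n1 + x2 * n2) * (x1 * v1 + x2 * v2)"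
    if "v1 * x2 = v2 * x1" for n1 n2 v1 v2 x1 x2 :: real
    using that by algebra
  from this[OF assms(5)] show ?thesis using assms(1-4) by (simp add: omega0_def inner_c2)
qed

text \<open>The functional \<open>\<omega>(x, \<cdot>)\<close> on the tangent plane of \<open>Q\<close> vanishes exactly on the tangent line of
  \<open>C\<close>, so two vectors completing the same \<open>t\<close> to a positive basis lie on the same side.\<close>

lemma positive_bases_same_side:
  assumes c: "c \<in> charts_at A p" and r: "0 < r"
    and Q: "\<And>q. q \<in> Q \<Longrightarrow> snd c q \<in> model_annulus r"
    and p: "p \<in> Q" "snd c p \<in> model_circle r"
    and ori: "surface_orientation A Q oriQ"
    and m1: "(m1, t1) \<in> oriQ p" and m2: "(m2, t2) \<in> oriQ p" and t: "t1 c = t2 c"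
    and im: "Im (fst (t1 c)) = 0" "Im (snd (t1 c)) = 0"
  shows "0 < omega0 (snd c p) (m1 c) * omega0 (snd c p) (m2 c)"
    and "m1 \<in> tangent_space A Q p" "m2 \<in> tangent_space A Q p"
proof -
  let ?x = "snd c p"
  from bspec[OF ori[unfolded surface_orientation_def] p(1)]
  obtain W e f where W: "p \<in> W" "\<forall>q\<in>Q \<inter> W.
      bij_betw (\<lambda>(a, b). lincomb a (e q) b (f q)) UNIV (tangent_space A Q q) \<and>
      oriQ q = {(lincomb a (e q) b (f q), lincomb a' (e q) b' (f q)) | a b a' b'.
                 a * b' - b * a' > 0}"
    by (elim exE conjE) (rule that)
  note frame = bspec[OF W(2) IntI[OF p(1) W(1)]]
  note bij = frame[THEN conjunct1] and oriQ = frame[THEN conjunct2]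
  have mem: "lincomb a (e p) b (f p) \<in> tangent_space A Q p" for a b
    using bspec[OF bij_betwE[OF bij], of "(a, b)"] by simp
  have inj: "a = a' \<and> b = b'" if "lincomb a (e p) b (f p) c = lincomb a' (e p) b' (f p) c" for a b a' b'
  proof -
    have "lincomb a (e p) b (f p) = lincomb a' (e p) b' (f p)"
      using that c mem tangent_space_tangent[of A Q p] by (intro tangent_eqI[where c = c]) auto
    then have "(\<lambda>(a, b). lincomb a (e p) b (f p)) (a, b) = (\<lambda>(a, b). lincomb a (e p) b (f p)) (a', b')"
      by simp
    then show ?thesis using injD[OF bij_betw_imp_inj_on[OF bij]] by blast
  qed
  obtain a1 b1 a b where 1: "m1 = lincomb a1 (e p) b1 (f p)" "t1 = lincomb a (e p) b (f p)"
    "a1 * b - b1 * a > 0" using m1 unfolding oriQ by blast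
  obtain a2 b2 a' b' where 2: "m2 = lincomb a2 (e p) b2 (f p)" "t2 = lincomb a' (e p) b' (f p)"
    "a2 * b' - b2 * a' > 0" using m2 unfolding oriQ by blast
  \<comment> \<open>\<open>t1\<close> and \<open>t2\<close> agree in the chart \<open>c\<close>,
    which already determines their coefficients in the frame.\<close>
  have ab: "a' = a" "b' = b" using inj[of a b a' b'] t 1(2) 2(2) by auto
  show "m1 \<in> tangent_space A Q p" "m2 \<in> tangent_space A Q p" using mem 1 2 by simp_all
  define B where "B v = omega0 ?x v" for v
  have imx: "Im (fst ?x) = 0" "Im (snd ?x) = 0" and xx: "?x \<noteq> 0"
    using p(2) r unfolding model_circle_def by auto
  have Blin: "B (lincomb a (e p) b (f p) c) = a * B (e p c) + b * B (f p c)" for a b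
    by (simp add: B_def omega0_def lincomb_def algebra_simps)
  \<comment> \<open>\<open>x\<close> and \<open>t1\<close> are both real in the chart, and
    \<open>omega0\<close> vanishes on the real plane.\<close>
  have Bt: "a * B (e p c) + b * B (f p c) = 0"
    using Blin[of a b] im imx unfolding 1(2)[symmetric] by (simp add: B_def omega0_def)
  have e_mem: "e p \<in> tangent_space A Q p" and f_mem: "f p \<in> tangent_space A Q p"
    using mem[of 1 0] mem[of 0 1] by (simp_all add: lincomb_def)
  \<comment> \<open>If \<open>B\<close> killed both frame vectors, they would be real and orthogonal
    to \<open>x\<close>, hence proportional.\<close>
  have B_nz: "B (e p c) \<noteq> 0 \<or> B (f p c) \<noteq> 0"
  proof (rule ccontr)
    assume "\<not> ?thesis"
    then have B0: "B (e p c) = 0" "B (f p c) = 0" by auto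
    have real: "Im (fst (v c)) = 0 \<and> Im (snd (v c)) = 0 \<and> ?x \<bullet> v c = 0"
      if v: "v \<in> tangent_space A Q p" and Bv: "B (v c) = 0" for v
    proof -
      note T = annulus_tangent_space[OF c r Q p v]
      have h: "Re (fst ?x) * Im (fst (v c)) + Re (snd ?x) * Im (snd (v c)) = 0"
        using Bv imx by (simp add: B_def omega0_def)
      \<comment> \<open>The imaginary part is both parallel and orthogonal to \<open>x\<close>, so
        it vanishes.\<close>
      have "(Re (fst ?x) * Re (fst ?x) + Re (snd ?x) * Re (snd ?x)) * Im (fst (v c)) = 0"
        "(Re (fst ?x) * Re (fst ?x) + Re (snd ?x) * Re (snd ?x)) * Im (snd (v c)) = 0"
        using h T(2) by algebra+
      moreover have "Re (fst ?x) * Re (fst ?x) + Re (snd ?x) * Re (snd ?x) \<noteq> 0"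
        using xx imx by (auto simp: prod_eq_iff complex_eq_iff sum_squares_eq_zero_iff)
      ultimately have "Im (fst (v c)) = 0" "Im (snd (v c)) = 0" by (meson mult_eq_0_iff)+
      then show ?thesis using T(1) imx by (simp add: inner_c2)
    qed
    have enz: "e p c \<noteq> 0" using inj[of 1 0 0 0] by (auto simp: lincomb_def)
    obtain k where "f p c = k *\<^sub>R e p c"
      using planar_collinear[OF imx _ _ _ _ xx enz] real[OF e_mem B0(1)] real[OF f_mem B0(2)] by blast
    then have "lincomb 0 (e p) 1 (f p) c = lincomb k (e p) 0 (f p) c" by (simp add: lincomb_def)
    then show False using inj by force
  qed
  have ab_nz: "a \<noteq> 0 \<or> b \<noteq> 0" using 1(3) by auto
  \<comment> \<open>The values of \<open>B\<close> on the frame are orthogonal to (a, b), hence a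
    multiple of (b, -a). Thus \<open>B\<close> is \<open>k\<close> times the determinant against
    \<open>t1\<close>, which is positive for \<open>m1\<close> and \<open>m2\<close>.\<close>
  obtain k where k: "B (e p c) = k * b" "B (f p c) = - k * a"
  proof (cases "a = 0")
    case True
    then show thesis using ab_nz Bt by (intro that[of "B (e p c) / b"]) auto
  next
    case False
    then show thesis using Bt by (intro that[of "- B (f p c) / a"]) (auto simp: field_simps)
  qed
  have "B (m1 c) = k * (a1 * b - b1 * a)" "B (m2 c) = k * (a2 * b - b2 * a)"
    unfolding 1(1) 2(1) Blin k by (simp_all add: algebra_simps)
  then have "B (m1 c) * B (m2 c) = k\<^sup>2 * ((a1 * b - b1 * a) * (a2 * b - b2 * a))"
    by (simp only: power2_eq_square mult_ac)
  moreover have "k \<noteq> 0" using k B_nz by auto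
  ultimately show "0 < omega0 ?x (m1 c) * omega0 ?x (m2 c)"
    using 1(3) 2(3) ab unfolding B_def by simp
qed

section \<open>The surgery in the model chart\<close>

text \<open>The identification prescribes only the image of \<open>L\<close> in the ball;
  injectivity of the chart carries the equality back to the manifold.\<close>

lemma annulus_part:
  assumes "is_chart c" "model_identification A \<omega> L D r c"
  shows "L \<inter> pull c (cball 0 r) = pull c (model_annulus r)"
proof -
  have eq: "snd c ` (L \<inter> fst c) \<inter> cball 0 r = model_annulus r"
    using assms(2) unfolding model_identification_def by blast
  have inj: "inj_on (snd c) (fst c)"
    using assms(1) chart_inv_left by (metis inj_on_inverseI)
  show ?thesis
  proof (intro equalityI subsetI)
    fix p assume "p \<in> pull c (model_annulus r)"
    then have p: "p \<in> fst c" "snd c p \<in> snd c ` (L \<inter> fst c)" "snd c p \<in> cball 0 r"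
      using eq unfolding pull_def by auto
    then obtain p1 where p1: "p1 \<in> L" "p1 \<in> fst c" "snd c p = snd c p1" by blast
    then have "p = p1" using inj p(1) unfolding inj_on_def by blast
    then have "p \<in> L" using p1 by simp
    then show "p \<in> L \<inter> pull c (cball 0 r)" using p unfolding pull_def by blast
  qed (use eq in \<open>auto simp: pull_def\<close>)
qed

lemma disk_part:
  assumes "is_chart c" "model_identification A \<omega> L D r c"
  shows "D = pull c (model_disk r)"
proof -
  have D: "D \<subseteq> fst c" "snd c ` D = model_disk r"
    using assms(2) unfolding model_identification_def by blast+
  have inj: "inj_on (snd c) (fst c)"
    using assms(1) chart_inv_left by (metis inj_on_inverseI)
  have "p \<in> D" if p: "p \<in> fst c" "snd c p \<in> model_disk r" for p
  proof -
    obtain p1 where p1: "p1 \<in> D" "snd c p = snd c p1" using p(2) D(2) by blast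
    then have "p = p1" using inj p(1) D(1) unfolding inj_on_def by blast
    then show ?thesis using p1 by simp
  qed
  then show ?thesis using D unfolding pull_def by blast
qed

lemma boundary_part:
  assumes "is_chart c" "model_identification A \<omega> L D r c"
  shows "D \<inter> L = pull c (model_circle r)"
proof -
  have r: "0 < r" using assms(2) unfolding model_identification_def by blast
  have "D \<inter> L = pull c (model_disk r) \<inter> (L \<inter> pull c (cball 0 r))"
    using disk_part[OF assms] model_disk_subset_cball[OF r] unfolding pull_def by blast
  also have "\<dots> = pull c (model_disk r \<inter> model_annulus r)"
    unfolding annulus_part[OF assms] by (auto simp: pull_def)
  finally show ?thesis unfolding model_disk_Int_annulus[OF r] .
qed

lemma dual_disk_part:
  assumes "is_chart c" "model_identification A \<omega> L D r c"
  shows "dual_disk c D = pull c (swap_xy ` model_disk r)"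
  using assms(2) unfolding dual_disk_def model_identification_def by simp

lemma dual_boundary_part:
  assumes "is_chart c" "model_identification A \<omega> L D r c"
  shows "dual_disk c D \<inter> la_surgery c r L = pull c (swap_xy ` model_circle r)"
proof -
  have r: "0 < r" using assms(2) unfolding model_identification_def by blast
  \<comment> \<open>The swap is an isometry, so \<open>D'\<close> also lies in the ball, where
    \<open>L\<close> consists of \<open>Q\<close> alone. Hence \<open>D'\<close> meets the surgered
    surface only in the new annulus.\<close>
  have "swap_xy ` model_disk r \<subseteq> cball 0 r"
    using model_disk_subset_cball[OF r] mem_cball_c2[OF r] inner_swap_xy by (metis image_subsetI subsetD)
  then have "dual_disk c D \<inter> (L - pull c (model_annulus r)) = {}"
    using annulus_part[OF assms] unfolding dual_disk_part[OF assms] pull_def by blast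
  then have "dual_disk c D \<inter> la_surgery c r L
      = pull c (swap_xy ` model_disk r) \<inter> pull c (swap_xy ` model_annulus r)"
    unfolding la_surgery_def dual_disk_part[OF assms] by blast
  also have "\<dots> = pull c (swap_xy ` (model_disk r \<inter> model_annulus r))"
    unfolding pull_def by (auto simp: mem_swap_xy_image)
  finally show ?thesis unfolding model_disk_Int_annulus[OF r] .
qed

lemma connected_boundary:
  assumes "is_chart c" "model_identification A \<omega> L D r c"
  shows "connected (D \<inter> L)"
proof -
  have r: "0 < r" and ball: "cball 0 r \<subseteq> snd c ` fst c"
    using assms(2) unfolding model_identification_def by blast+
  have sub: "model_circle r \<subseteq> snd c ` fst c"
    using model_circle_subset_disk model_disk_subset_cball[OF r] ball by blast
  have "pull c (model_circle r) = chart_inv c ` model_circle r"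
  proof (intro equalityI subsetI)
    fix p assume "p \<in> pull c (model_circle r)"
    then show "p \<in> chart_inv c ` model_circle r"
      unfolding pull_def using chart_inv_left[OF assms(1)] by force
  next
    fix p assume "p \<in> chart_inv c ` model_circle r"
    then show "p \<in> pull c (model_circle r)"
      using sub by (auto simp: pull_def chart_inv_mem chart_inv_right subset_iff)
  qed
  moreover have "continuous_on (model_circle r) (chart_inv c)"
    using assms(1) unfolding is_chart_def homeomorphism_def
    by (intro continuous_on_subset[OF _ sub]) simp
  ultimately show ?thesis
    unfolding boundary_part[OF assms]
    using connected_continuous_image connected_model_circle by metis
qed

section \<open>Comparison of the signs along the two circles\<close>

lemma connected_same_sign:
  fixes g :: "'a::topological_space \<Rightarrow> real"
  assumes "connected S" "continuous_on S g" "\<And>x. x \<in> S \<Longrightarrow> g x \<noteq> 0" "x \<in> S" "y \<in> S"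
  shows "0 < g x * g y"
proof (rule ccontr)
  assume "\<not> 0 < g x * g y"
  then have "g x \<le> 0 \<and> 0 \<le> g y \<or> g y \<le> 0 \<and> 0 \<le> g x"
    by (metis linorder_linear mult_neg_neg mult_pos_pos not_le)
  moreover have "connected (g ` S)" using assms(1,2) connected_continuous_image by blast
  ultimately have "0 \<in> g ` S" using assms(4,5) connectedD_interval by (metis imageI)
  then show False using assms(3) by force
qed

theorem proposition2p3p4:
  fixes A :: "'a::{t2_space, second_countable_topology} chart set"
    and \<omega> :: "'a \<Rightarrow> 'a tvec \<Rightarrow> 'a tvec \<Rightarrow> real"
    and L D L' D' :: "'a set" and r :: real and c :: "'a chart"
  assumes "symplectic_manifold A \<omega>"
    and "lagrangian_surface A \<omega> L"
    and "la_disk A \<omega> L D"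
    and "model_identification A \<omega> L D r c"
    and "L' = la_surgery c r L"
    and "D' = dual_disk c D"
  shows "opposite_relative_polarity A \<omega> c r L D L' D'"
  unfolding opposite_relative_polarity_def
proof (intro allI impI ballI)
  fix n m n' m' p p'
  assume fields: "polarity_fields A c r L D L' D' n m n' m'"
    and p: "p \<in> D \<inter> L" and p': "p' \<in> D' \<inter> L'"
  note mi = assms(4)
  have cA: "c \<in> A" and r: "0 < r" and ball: "cball 0 r \<subseteq> snd c ` fst c"
    and \<omega>: "\<And>q u v. q \<in> fst c \<Longrightarrow> u \<in> tangent A q \<Longrightarrow> v \<in> tangent A q \<Longrightarrow> \<omega> q u v = omega0 (u c) (v c)"
    using mi unfolding model_identification_def by blast+
  have ch: "is_chart c"
    using assms(1) cA unfolding symplectic_manifold_def smooth_structure_def by blast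
  define Q C C' where "Q = L \<inter> pull c (cball 0 r)" and "C = D \<inter> L" and "C' = D' \<inter> L'"
  have Q: "Q = pull c (model_annulus r)" unfolding Q_def by (rule annulus_part[OF ch mi])
  have C: "C = pull c (model_circle r)" unfolding C_def by (rule boundary_part[OF ch mi])
  have C': "C' = pull c (swap_xy ` model_circle r)"
    unfolding C'_def assms(5,6) by (rule dual_boundary_part[OF ch mi])
  have CQ: "C \<subseteq> Q" unfolding C Q pull_def using model_circle_subset_annulus by blast
  have Q_model: "\<And>q. q \<in> Q \<Longrightarrow> snd c q \<in> model_annulus r"
    and C_model: "\<And>q. q \<in> C \<Longrightarrow> snd c q \<in> model_circle r"
    and C_fst: "\<And>q. q \<in> C \<Longrightarrow> q \<in> fst c"
    and C'_model: "\<And>q. q \<in> C' \<Longrightarrow> swap_xy (snd c q) \<in> model_circle r"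
    and C'_fst: "\<And>q. q \<in> C' \<Longrightarrow> q \<in> fst c"
    unfolding Q C C' pull_def mem_swap_xy_image by auto
  have D_model: "\<And>q. q \<in> D \<Longrightarrow> snd c q \<in> model_disk r"
    using disk_part[OF ch mi] unfolding pull_def by blast
  have D'_model: "\<And>q. q \<in> D' \<Longrightarrow> swap_xy (snd c q) \<in> model_disk r"
    using dual_disk_part[OF ch mi] unfolding assms(6) pull_def mem_swap_xy_image by blast
  obtain oriQ oriC oriQ' oriC' where
    oQ: "surface_orientation A Q oriQ" and oC: "curve_orientation A C oriC" and
    oC': "curve_orientation A C' oriC'" and
    tr: "transported_orientations A c Q oriQ C oriC oriQ' oriC'" and
    n: "outward_normal A D C n" and m: "positive_normal A C oriQ oriC m" and
    n': "outward_normal A D' C' n'" and m': "positive_normal A C' oriQ' oriC' m'"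
    using fields unfolding polarity_fields_def Let_def Q_def C_def C'_def by blast

  define g where "g q = omega0 (n q c) (m q c)" for q
  have \<omega>g: "\<omega> q (n q) (m q) = g q" if "q \<in> C" for q
    unfolding g_def using that n m C_fst
    unfolding outward_normal_def positive_normal_def continuous_field_def by (intro \<omega>) auto
  \<comment> \<open>A positive tangent vector of \<open>C\<close>; its chart coordinates are real,
    as the comparison of positive bases requires.\<close>
  have local: "\<exists>t. t \<in> oriC q \<and> (m q, t) \<in> oriQ q \<and> Im (fst (t c)) = 0 \<and> Im (snd (t c)) = 0"
    if q: "q \<in> C" for q
  proof -
    have cq: "c \<in> charts_at A q" using C_fst[OF q] cA unfolding charts_at_def by blast
    obtain e where e: "bij_betw (\<lambda>a. multiple a (e q)) UNIV (tangent_space A C q)"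
      "oriC q = {multiple a (e q) | a. a > 0}"
      using oC q unfolding curve_orientation_def by blast
    let ?t = "multiple 1 (e q)"
    have t: "?t \<in> oriC q" unfolding e(2) using zero_less_one by blast
    have "?t \<in> tangent_space A C q" using e(1) unfolding bij_betw_def by blast
    from circle_tangent_space[OF bounded_linear_ident cq C_model q this]
    have "Im (fst (?t c)) = 0" "Im (snd (?t c)) = 0" by blast+
    then show ?thesis using t m q unfolding positive_normal_def by blast
  qed
  have sign: "g q * (snd c q \<bullet> snd c q) = (snd c q \<bullet> n q c) * omega0 (snd c q) (m q c)"
    and out: "0 < snd c q \<bullet> n q c" and side: "omega0 (snd c q) (m q c) \<noteq> 0"
    and xx: "0 < snd c q \<bullet> snd c q"
    if q: "q \<in> C" for q
  proof -
    have cq: "c \<in> charts_at A q" using C_fst[OF q] cA unfolding charts_at_def by blast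
    have qQ: "q \<in> Q" using q CQ by blast
    have imx: "Im (fst (snd c q)) = 0" "Im (snd (snd c q)) = 0"
      using C_model[OF q] unfolding model_circle_def by auto
    show "0 < snd c q \<bullet> snd c q" using C_model[OF q] r unfolding model_circle_def by auto
    note N = outward_normal_coords[OF bounded_linear_ident inj_on_id2 cq r D_model C_model q oC n]
    obtain t where t: "(m q, t) \<in> oriQ q" "Im (fst (t c)) = 0" "Im (snd (t c)) = 0"
      using local[OF q] by blast
    \<comment> \<open>Comparing the basis with itself gives a positive square, so \<omega>(x,
      \<open>m q\<close>) is nonzero.\<close>
    note P = positive_bases_same_side[OF cq r Q_model qQ C_model[OF q] oQ t(1) t(1) refl t(2,3)]
    show "0 < snd c q \<bullet> n q c" by (rule N(3))
    show "omega0 (snd c q) (m q c) \<noteq> 0" using P(1) by auto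
    show "g q * (snd c q \<bullet> snd c q) = (snd c q \<bullet> n q c) * omega0 (snd c q) (m q c)"
      unfolding g_def
      by (rule omega0_outward[OF N(1,2) imx
            annulus_tangent_space(2)[OF cq r Q_model qQ C_model[OF q] P(2)]])
  qed
  have g_nz: "g q \<noteq> 0" if "q \<in> C" for q
    using sign[OF that] out[OF that] side[OF that] by auto
  have g_cont: "continuous_on C g"
  proof -
    have "C \<inter> fst c = C" using C_fst by blast
    then have "continuous_on C (\<lambda>q. n q c)" "continuous_on C (\<lambda>q. m q c)"
      using n m cA unfolding outward_normal_def positive_normal_def continuous_field_def by force+
    then show ?thesis unfolding g_def omega0_def by (intro continuous_intros)
  qed

  \<comment> \<open>As the swap is an involution, \<open>q\<close> is the point of \<open>C\<close>
    that the transport carries to \<open>p'\<close>.\<close>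
  define q where "q = chart_inv c (swap_xy (snd c p'))"
  have p'C': "p' \<in> C'" using p' unfolding C'_def .
  have xq: "swap_xy (snd c p') \<in> model_circle r" by (rule C'_model[OF p'C'])
  then have "swap_xy (snd c p') \<in> snd c ` fst c"
    using model_circle_subset_disk model_disk_subset_cball[OF r] ball by blast
  then have q_fst: "q \<in> fst c" and sq: "snd c q = swap_xy (snd c p')"
    unfolding q_def by (rule chart_inv_mem, rule chart_inv_right)
  have qC: "q \<in> C" unfolding C pull_def using q_fst sq xq by simp
  have qQ: "q \<in> Q" using qC CQ by blast
  have fq: "flow c pi q = p'"
    unfolding flow_def M_isotopy_pi sq by (simp add: chart_inv_left[OF ch C'_fst[OF p'C']])
  have cq: "c \<in> charts_at A q" and cp': "c \<in> charts_at A p'"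
    using q_fst C'_fst[OF p'C'] cA unfolding charts_at_def by blast+
  have fv: "flow_vec A c pi q u c = swap_xy (u c)" for u
    unfolding flow_vec_def fq M_isotopy_pi by (rule of_coords_same_chart[OF ch cp'])
  obtain t where t: "t \<in> oriC q" "(m q, t) \<in> oriQ q" "Im (fst (t c)) = 0" "Im (snd (t c)) = 0"
    using local[OF qC] by blast
  have "flow_vec A c pi q t \<in> oriC' p'"
    using tr qC t(1) fq unfolding transported_orientations_def by blast
  then have "(m' p', flow_vec A c pi q t) \<in> oriQ' p'"
    using m' p'C' unfolding positive_normal_def by blast
  then have "(m' p', flow_vec A c pi q t)
      \<in> map_prod (flow_vec A c pi q) (flow_vec A c pi q) ` oriQ q"
    using tr qQ fq unfolding transported_orientations_def by metis
  \<comment> \<open>Pulling the positive basis at \<open>p'\<close> back to \<open>q\<close> gives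
    \<open>m2\<close>, to be compared with \<open>m q\<close>: both complete the same tangent vector
    in the chart.\<close>
  then obtain m2 t2 where mt: "(m2, t2) \<in> oriQ q" "m' p' = flow_vec A c pi q m2"
    "flow_vec A c pi q t = flow_vec A c pi q t2" by auto
  have t2: "t c = t2 c" using mt(3) fv by (metis swap_xy_swap_xy)
  have m'c: "m' p' c = swap_xy (m2 c)" using mt(2) fv by simp
  note P = positive_bases_same_side[OF cq r Q_model qQ C_model[OF qC] oQ t(2) mt(1) t2 t(3,4)]
  define n2 where "n2 = swap_xy (n' p' c)"
  have inj_swap: "inj swap_xy" by (metis injI swap_xy_swap_xy)
  \<comment> \<open>With the swap as \<open>J\<close>, the pulled-back normal \<open>n2\<close> is
    real and points outward from \<open>D\<close> at \<open>q\<close>.\<close>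
  note N' = outward_normal_coords[OF bounded_linear_swap_xy inj_swap cp' r D'_model C'_model p'C' oC' n',
      folded sq n2_def]
  have imx: "Im (fst (snd c q)) = 0" "Im (snd (snd c q)) = 0"
    using C_model[OF qC] unfolding model_circle_def by auto
  have sign': "omega0 n2 (m2 c) * (snd c q \<bullet> snd c q) = (snd c q \<bullet> n2) * omega0 (snd c q) (m2 c)"
    by (rule omega0_outward[OF N'(1,2) imx
          annulus_tangent_space(2)[OF cq r Q_model qQ C_model[OF qC] P(3)]])
  have "\<omega> p' (n' p') (m' p') = omega0 (n' p' c) (m' p' c)"
    using p'C' n' m' C'_fst
    unfolding outward_normal_def positive_normal_def continuous_field_def by (intro \<omega>) auto
  \<comment> \<open>The opposite polarity comes from this sign; the positive bases and outward
    directions are preserved by the swap.\<close>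
  also have "\<dots> = - omega0 n2 (m2 c)"
    unfolding m'c n2_def using omega0_swap_xy[of "n' p' c" "swap_xy (m2 c)"] by simp
  finally have \<omega>': "\<omega> p' (n' p') (m' p') = - omega0 n2 (m2 c)" .
  \<comment> \<open>Multiplying the sign identities for the two normals leaves two positive radial
    factors and the positive product for \<open>m q\<close> and \<open>m2\<close>.\<close>
  have "(g q * omega0 n2 (m2 c)) * (snd c q \<bullet> snd c q)\<^sup>2
      = (snd c q \<bullet> n q c) * (snd c q \<bullet> n2) * (omega0 (snd c q) (m q c) * omega0 (snd c q) (m2 c))"
    using arg_cong2[OF sign[OF qC] sign', of "(*)"] by (simp only: power2_eq_square mult_ac)
  also have "\<dots> > 0" using out[OF qC] N'(3) P(1) by simp
  finally have gq: "0 < g q * omega0 n2 (m2 c)"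
    by (metis mult_less_cancel_right_pos mult_zero_left xx[OF qC] zero_less_power)
  have pC: "p \<in> C" using p unfolding C_def .
  have conn: "connected C" unfolding C_def by (rule connected_boundary[OF ch mi])
  \<comment> \<open>\<open>p\<close> and \<open>p'\<close> are unrelated; connectedness of
    \<open>C\<close> moves the comparison from \<open>q\<close> to \<open>p\<close>.\<close>
  have "0 < g p * g q" by (rule connected_same_sign[OF conn g_cont g_nz pC qC])
  then have "0 < g p * omega0 n2 (m2 c)" using gq by (auto simp: zero_less_mult_iff)
  then show "\<omega> p (n p) (m p) * \<omega> p' (n' p') (m' p') < 0"
    unfolding \<omega>g[OF pC] \<omega>' by simp
qed

end
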